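(* Let $d \geq 0$ be an integer with $d \equiv 0 \pmod{3}$ and $d \neq 6$. Then the graph $G_3(d)$ has exactly one maximum independent set, i.e. $\mathrm{a}_3(d) = 1$.
   Context: For integers $n \geq 1$ and $d \geq 0$, let $S_n(d)$ be the set of monomials of degree $d$ in the polynomial ring $\mathbb{F}[x_1,\dots,x_n]$ over a field $\mathbb{F}$. The graph $G_n(d)$ has vertex set $S_n(d)$, and two monomials $f,g \in S_n(d)$ are adjacent if and only if $\mathrm{lcm}(f,g)$ has degree $d+1$. (Equivalently, vertices are $n$-tuples of nonnegative integers summing to $d$, adjacent iff their $L_1$ distance is $2$.) A maximum independent set is an independent set of largest possible size, and $\mathrm{a}_n(d)$ denotes the number of maximum independent sets of $G_n(d)$. *)

theory Defs
  imports "HOL-Library.Poly_Mapping" "HOL-Library.Ramsey"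
begin

text \<open>
  A monomial in the variables $x_1, x_2, \dots$ is identified with its exponent vector, a finitely
  supported function; the coefficient field plays no role. Multiplication of monomials
  is addition of exponent vectors.
\<close>

type_synonym monomial = "nat \<Rightarrow>\<^sub>0 nat"

definition mono_degree :: "monomial \<Rightarrow> nat" where
  "mono_degree f = (\<Sum>i\<in>Poly_Mapping.keys f. Poly_Mapping.lookup f i)"

definition mono_dvd :: "monomial \<Rightarrow> monomial \<Rightarrow> bool" where
  "mono_dvd f g \<longleftrightarrow> (\<exists>h. g = f + h)"

lift_definition mono_lcm :: "monomial \<Rightarrow> monomial \<Rightarrow> monomial"
  is "\<lambda>f g i. max (f i) (g i)"
proof -
  fix f g :: "nat \<Rightarrow> nat"
  assume "finite {i. f i \<noteq> 0}" and "finite {i. g i \<noteq> 0}"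
  then have "finite ({i. f i \<noteq> 0} \<union> {i. g i \<noteq> 0})" by simp
  then show "finite {i. max (f i) (g i) \<noteq> 0}"
    by (rule rev_finite_subset) auto
qed

lemma mono_dvd_iff: "mono_dvd f g \<longleftrightarrow> (\<forall>i. Poly_Mapping.lookup f i \<le> Poly_Mapping.lookup g i)"
proof
  assume "mono_dvd f g"
  then show "\<forall>i. Poly_Mapping.lookup f i \<le> Poly_Mapping.lookup g i"
    by (auto simp: mono_dvd_def lookup_add)
next
  assume "\<forall>i. Poly_Mapping.lookup f i \<le> Poly_Mapping.lookup g i"
  then have "g = f + (g - f)"
    by (intro poly_mapping_eqI) (simp add: lookup_add lookup_minus)
  then show "mono_dvd f g"
    unfolding mono_dvd_def by blast
qed

lemma mono_lcm_is_lcm: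
  "mono_dvd f (mono_lcm f g)" "mono_dvd g (mono_lcm f g)"
  "mono_dvd f h \<Longrightarrow> mono_dvd g h \<Longrightarrow> mono_dvd (mono_lcm f g) h"
  by (simp_all add: mono_dvd_iff mono_lcm.rep_eq)

text \<open>The set $S_n(d)$; the variables $x_1, \dots, x_n$ are indexed by \<open>{1..n}\<close>.\<close>

definition monomials :: "nat \<Rightarrow> nat \<Rightarrow> monomial set" where
  "monomials n d = {f. Poly_Mapping.keys f \<subseteq> {1..n} \<and> mono_degree f = d}"

text \<open>
  The edge set of $G_n(d)$ on the vertex set \<open>monomials n d\<close>. There are no
  loops, as the lcm of \<open>f\<close> with itself has degree \<open>d\<close>.
\<close>

definition G_edges :: "nat \<Rightarrow> nat \<Rightarrow> monomial set set" where
  "G_edges n d = {{f, g} | f g. f \<in> monomials n d \<and> g \<in> monomials n d \<and>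
                                 mono_degree (mono_lcm f g) = d + 1}"

definition max_indep_sets :: "'a set \<Rightarrow> 'a set set \<Rightarrow> 'a set set" where
  "max_indep_sets V E = {I. I \<subseteq> V \<and> indep I E \<and> (\<forall>J. J \<subseteq> V \<and> indep J E \<longrightarrow> card J \<le> card I)}"

definition num_max_indep :: "nat \<Rightarrow> nat \<Rightarrow> nat" where
  "num_max_indep n d = card (max_indep_sets (monomials n d) (G_edges n d))"

lemma finite_monomials: "finite (monomials n d)"
proof -
  have "Poly_Mapping.lookup ` monomials n d \<subseteq> {h. \<forall>i. (i \<in> {1..n} \<longrightarrow> h i \<in> {..d}) \<and> (i \<notin> {1..n} \<longrightarrow> h i = 0)}"
  proof clarify
    fix f i assume f: "f \<in> monomials n d"
    have "Poly_Mapping.lookup f i \<le> d"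
    proof (cases "i \<in> Poly_Mapping.keys f")
      case True
      then have "Poly_Mapping.lookup f i \<le> mono_degree f"
        unfolding mono_degree_def by (intro member_le_sum) auto
      then show ?thesis using f by (simp add: monomials_def)
    qed (simp add: in_keys_iff)
    moreover have "i \<notin> {1..n} \<Longrightarrow> Poly_Mapping.lookup f i = 0"
      using f by (auto simp: monomials_def in_keys_iff subset_iff)
    ultimately show "(i \<in> {1..n} \<longrightarrow> Poly_Mapping.lookup f i \<in> {..d}) \<and> (i \<notin> {1..n} \<longrightarrow> Poly_Mapping.lookup f i = 0)"
      by auto
  qed
  moreover have "finite {h. \<forall>i. (i \<in> {1..n} \<longrightarrow> h i \<in> {..d}) \<and> (i \<notin> {1..n} \<longrightarrow> h i = (0::nat))}"
    by (rule finite_set_of_finite_funs) auto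
  ultimately have "finite (Poly_Mapping.lookup ` monomials n d)"
    by (rule finite_subset)
  then show ?thesis
    by (rule finite_imageD) (simp add: inj_on_def lookup_inject)
qed

end

theory Submission
  imports Defs
begin

text \<open>
  Write monomials of degree \<open>3 * k\<close> as triples \<open>(x, y, z)\<close> with \<open>x + y + z = 3 * k\<close>; the unique maximum
  independent set will be the class of triples with pairwise congruent entries modulo 3. The triples
  with minimum at most 1 form an annulus that is tiled by triangles (cliques), and the remaining
  ones form a copy of the graph for \<open>k - 2\<close>. So a maximum independent set meets every tile exactly
  once, also after permuting the coordinates, and its inner part is again maximum. If the inner part
  is the congruence class, then the tiles of the tiling and of its mirror image force the
  congruence class on the annulus once \<open>k \<ge> 3\<close>. For \<open>k = 2\<close> a second maximum set exists, but the
  tiles for \<open>k = 4\<close> rule it out as an inner part.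
\<close>

section \<open>Independent sets of triples\<close>

declare add_2_eq_Suc [simp del] add_2_eq_Suc' [simp del]

definition simplex_pts :: "nat \<Rightarrow> (nat \<times> nat \<times> nat) set" where
  "simplex_pts d = {(x, y, z). x + y + z = d}"

text \<open>Two triples are adjacent iff they lie in a common triangle \<open>(a, b, c) + e\<^sub>i\<close>, \<open>i = 1, 2, 3\<close>,
  where \<open>(a, b, c)\<close> is their greatest common divisor.\<close>

definition spread :: "(nat \<times> nat \<times> nat) set \<Rightarrow> bool" where
  "spread J \<longleftrightarrow> (\<forall>a b c. \<not> ((Suc a, b, c) \<in> J \<and> (a, Suc b, c) \<in> J) \<and>
                            \<not> ((Suc a, b, c) \<in> J \<and> (a, b, Suc c) \<in> J) \<and>
                            \<not> ((a, Suc b, c) \<in> J \<and> (a, b, Suc c) \<in> J))"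

definition diag_class :: "nat \<Rightarrow> (nat \<times> nat \<times> nat) set" where
  "diag_class k = {(x, y, z). x + y + z = 3 * k \<and> x mod 3 = y mod 3 \<and> y mod 3 = z mod 3}"

definition rot :: "(nat \<times> nat \<times> nat) set \<Rightarrow> (nat \<times> nat \<times> nat) set" where
  "rot J = {(x, y, z). (y, z, x) \<in> J}"

definition mir :: "(nat \<times> nat \<times> nat) set \<Rightarrow> (nat \<times> nat \<times> nat) set" where
  "mir J = {(x, y, z). (z, y, x) \<in> J}"

definition inner :: "(nat \<times> nat \<times> nat) set \<Rightarrow> (nat \<times> nat \<times> nat) set" where
  "inner J = {(x, y, z). (x + 2, y + 2, z + 2) \<in> J}"

text \<open>A strip of small \<open>y\<close> followed by large \<open>z\<close>; this cyclic cut
  makes the strips of \<open>J\<close>, \<open>rot J\<close> and \<open>rot (rot J)\<close> disjoint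
  once turned back.\<close>

definition side :: "(nat \<times> nat \<times> nat) set \<Rightarrow> (nat \<times> nat \<times> nat) set" where
  "side J = {(x, y, z). (x, y, z) \<in> J \<and> y \<le> 1 \<and> 2 \<le> z}"

lemma mem_rot [simp]: "(x, y, z) \<in> rot J \<longleftrightarrow> (y, z, x) \<in> J"
  and mem_mir [simp]: "(x, y, z) \<in> mir J \<longleftrightarrow> (z, y, x) \<in> J"
  and mem_inner [simp]: "(x, y, z) \<in> inner J \<longleftrightarrow> (x + 2, y + 2, z + 2) \<in> J"
  and mem_side [simp]: "(x, y, z) \<in> side J \<longleftrightarrow> (x, y, z) \<in> J \<and> y \<le> 1 \<and> 2 \<le> z"
  and mem_simplex_pts [simp]: "(x, y, z) \<in> simplex_pts d \<longleftrightarrow> x + y + z = d"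
  and mem_diag_class: "(x, y, z) \<in> diag_class k \<longleftrightarrow>
    x + y + z = 3 * k \<and> x mod 3 = y mod 3 \<and> y mod 3 = z mod 3"
  by (simp_all add: rot_def mir_def inner_def side_def simplex_pts_def diag_class_def)

lemma spreadD:
  assumes "spread J"
  shows "\<not> ((Suc a, b, c) \<in> J \<and> (a, Suc b, c) \<in> J)"
    "\<not> ((Suc a, b, c) \<in> J \<and> (a, b, Suc c) \<in> J)"
    "\<not> ((a, Suc b, c) \<in> J \<and> (a, b, Suc c) \<in> J)"
  using assms unfolding spread_def by blast+

lemma finite_simplex_pts: "finite (simplex_pts d)"
  by (rule finite_subset [of _ "{..d} \<times> {..d} \<times> {..d}"]) (auto simp: simplex_pts_def)

lemma card_rot [simp]: "card (rot J) = card J"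
proof -
  have "bij_betw (\<lambda>(x, y, z). (y, z, x)) (rot J) J"
    by (rule bij_betw_byWitness [where f' = "\<lambda>(x, y, z). (z, x, y)"]) auto
  then show ?thesis by (rule bij_betw_same_card)
qed

lemma card_mir [simp]: "card (mir J) = card J"
proof -
  have "bij_betw (\<lambda>(x, y, z). (z, y, x)) (mir J) J"
    by (rule bij_betw_byWitness [where f' = "\<lambda>(x, y, z). (z, y, x)"]) auto
  then show ?thesis by (rule bij_betw_same_card)
qed

lemma spread_rot [simp]: "spread J \<Longrightarrow> spread (rot J)"
  and spread_mir [simp]: "spread J \<Longrightarrow> spread (mir J)"
  and spread_inner [simp]: "spread J \<Longrightarrow> spread (inner J)"
  unfolding spread_def mem_rot mem_mir mem_inner add_Suc by blast+

lemma rot_subset [simp]: "J \<subseteq> simplex_pts d \<Longrightarrow> rot J \<subseteq> simplex_pts d"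
  and mir_subset [simp]: "J \<subseteq> simplex_pts d \<Longrightarrow> mir J \<subseteq> simplex_pts d"
  and inner_subset: "J \<subseteq> simplex_pts (d + 6) \<Longrightarrow> inner J \<subseteq> simplex_pts d"
  by (force simp: subset_iff)+

lemma rot_diag_class [simp]: "rot (diag_class k) = diag_class k"
  and mir_diag_class [simp]: "mir (diag_class k) = diag_class k"
  by (auto simp: mem_diag_class)

lemma inner_diag_class: "inner (diag_class (k + 2)) = diag_class k"
proof -
  have "(x + 2) mod 3 = (y + 2) mod 3 \<longleftrightarrow> x mod 3 = y mod 3" for x y :: nat
    by (simp add: mod_Suc add_2_eq_Suc')
  then show ?thesis by (auto simp: mem_diag_class)
qed

lemma diag_class_subset: "diag_class k \<subseteq> simplex_pts (3 * k)"
  by (auto simp: mem_diag_class)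

text \<open>Adjacent triples share one coordinate, whose residue would have to equal those of both
  \<open>a\<close> and \<open>Suc a\<close>.\<close>

lemma spread_diag_class: "spread (diag_class k)"
proof -
  have "Suc a mod 3 \<noteq> a mod 3" for a :: nat by (simp add: mod_Suc)
  then show ?thesis unfolding spread_def mem_diag_class by metis
qed

section \<open>Tiling the boundary annulus\<close>

text \<open>The strip \<open>y \<le> 1 \<and> 2 \<le> z\<close> is tiled by \<open>2 * k - 1\<close> alternating triangles, the fibres
  of \<open>(2 * x + y) div 3\<close>.\<close>

lemma side_inj_on:
  assumes J: "J \<subseteq> simplex_pts d" "spread J"
  shows "inj_on (\<lambda>(x, y, z). (2 * x + y) div 3) (side J)"
proof -
  have "x = x' \<and> y = y' \<and> z = z'" if p: "(x, y, z) \<in> side J" "(x', y', z') \<in> side J"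
    and eq: "(2 * x + y) div 3 = (2 * x' + y') div 3" for x y z x' y' z'
  proof -
    have q: "(x, y, z) \<in> J" "(x', y', z') \<in> J" "y = 0 \<or> y = 1" "y' = 0 \<or> y' = 1"
      "x + y + z = d" "x' + y' + z' = d"
      using p J(1) by auto
    have "2 * x + y < 2 * x' + y' + 3" "2 * x' + y' < 2 * x + y + 3"
      using eq div_mult_mod_eq [of "2 * x + y" 3] div_mult_mod_eq [of "2 * x' + y'" 3]
        mod_less_divisor [of 3 "2 * x + y"] mod_less_divisor [of 3 "2 * x' + y'"] by linarith+
    \<comment> \<open>Values of \<open>2 * x + y\<close> in one fibre differ by at most 2. In each
      surviving case the equal sums determine \<open>z\<close>, and the two points coincide or are
      adjacent.\<close>
    then consider "y = y'" "x = x' \<or> x = Suc x' \<or> x' = Suc x" | "y = 0" "y' = 1" "x = x' \<or> x = Suc x'"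
      | "y = 1" "y' = 0" "x = x' \<or> x' = Suc x"
      using q(3,4) by (elim disjE) fastforce+
    then show ?thesis
    proof cases
      case 1
      then have "(x = x' \<and> z = z') \<or> (x = Suc x' \<and> z' = Suc z) \<or> (x' = Suc x \<and> z = Suc z')"
        using q(5,6) by auto
      with 1(1) show ?thesis using spreadD(2) [OF J(2)] q(1,2) by blast
    next
      case 2
      then have "(x = x' \<and> z = Suc z') \<or> (x = Suc x' \<and> z = z')"
        using q(5,6) by auto
      with 2(1,2) show ?thesis using spreadD(1,3) [OF J(2)] q(1,2) by auto
    next
      case 3
      then have "(x = x' \<and> z' = Suc z) \<or> (x' = Suc x \<and> z = z')"
        using q(5,6) by auto
      with 3(1,2) show ?thesis using spreadD(1,3) [OF J(2)] q(1,2) by auto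
    qed
  qed
  then show ?thesis by (fastforce intro: inj_onI)
qed

lemma side_range:
  assumes "J \<subseteq> simplex_pts (3 * k)"
  shows "(\<lambda>(x, y, z). (2 * x + y) div 3) ` side J \<subseteq> {..<2 * k - 1}"
proof -
  have "(2 * x + y) div 3 < 2 * k - 1" if "(x, y, z) \<in> side J" for x y z
  proof -
    \<comment> \<open>Here \<open>2 * x + y = 6 * k - y - 2 * z \<le> 6 * k - 4\<close>, so the
      quotient is at most \<open>2 * k - 2\<close>.\<close>
    have "x + y + z = 3 * k" "y \<le> 1" "2 \<le> z" using assms that by auto
    then show ?thesis by simp
  qed
  then show ?thesis by auto
qed

lemma finite_side: "J \<subseteq> simplex_pts d \<Longrightarrow> finite (side J)"
  by (rule finite_subset [OF _ finite_simplex_pts [of d]]) auto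

lemma card_side_le:
  assumes "J \<subseteq> simplex_pts (3 * k)" "spread J"
  shows "card (side J) \<le> 2 * k - 1"
  using card_inj_on_le [OF side_inj_on [OF assms] side_range [OF assms(1)]] by simp

lemma card_sides_le:
  assumes "J \<subseteq> simplex_pts (3 * k)" "spread J"
  shows "card (side J) \<le> 2 * k - 1" "card (side (rot J)) \<le> 2 * k - 1"
    "card (side (rot (rot J))) \<le> 2 * k - 1"
  using card_side_le [OF assms] card_side_le [OF rot_subset spread_rot, OF assms]
    card_side_le [OF rot_subset [OF rot_subset] spread_rot [OF spread_rot], OF assms]
  by blast+

text \<open>Equality in \<open>card_side_le\<close> turns the injection into the tile indices into a
  surjection, so no tile is missed.\<close>

lemma side_tile_hit:
  assumes J: "J \<subseteq> simplex_pts (3 * k)" "spread J" and c: "card (side J) = 2 * k - 1"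
    and n: "n < 2 * k - 1"
  shows "\<exists>x y z. (x, y, z) \<in> J \<and> x + y + z = 3 * k \<and> y \<le> 1 \<and> (2 * x + y) div 3 = n"
proof -
  let ?f = "\<lambda>(x, y, z). (2 * x + y) div 3 :: nat"
  have "?f ` side J = {..<2 * k - 1}"
    using side_range [OF J(1)] card_image [OF side_inj_on [OF J]] c
    by (intro card_subset_eq) auto
  then have "n \<in> ?f ` side J" using n by simp
  then show ?thesis using J(1) by fastforce
qed

text \<open>The tile of even index \<open>2 * j\<close> is the triangle obtained from
  \<open>(3 * j, 0, 3 * m + 2)\<close> by raising one coordinate by 1.\<close>

lemma side_up_hit:
  assumes J: "J \<subseteq> simplex_pts (3 * k)" "spread J" "card (side J) = 2 * k - 1"
    and k: "j + m + 1 = k"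
  shows "(3 * j, 0, 3 * m + 3) \<in> J \<or> (3 * j + 1, 0, 3 * m + 2) \<in> J \<or> (3 * j, 1, 3 * m + 2) \<in> J"
proof -
  obtain x y z where p: "(x, y, z) \<in> J" "x + y + z = 3 * k" "y \<le> 1" "(2 * x + y) div 3 = 2 * j"
    using side_tile_hit [OF J, of "2 * j"] k by auto
  have "6 * j \<le> 2 * x + y" "2 * x + y \<le> 6 * j + 2"
    using p(4) div_mult_mod_eq [of "2 * x + y" 3] mod_less_divisor [of 3 "2 * x + y"] by linarith+
  with p(3) have "(y = 0 \<and> (x = 3 * j \<or> x = 3 * j + 1)) \<or> (y = 1 \<and> (x = 3 * j))"
    by (cases y) auto
  with p(2) k have "(x = 3 * j \<and> y = 0 \<and> z = 3 * m + 3) \<or> (x = 3 * j + 1 \<and> y = 0 \<and> z = 3 * m + 2) \<or>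
    (x = 3 * j \<and> y = 1 \<and> z = 3 * m + 2)"
    by auto
  with p(1) show ?thesis by blast
qed

text \<open>The tile of odd index \<open>2 * j + 1\<close> is the inverted triangle obtained from
  \<open>(3 * j + 2, 1, 3 * m + 4)\<close> by lowering one coordinate by 1.\<close>

lemma side_down_hit:
  assumes J: "J \<subseteq> simplex_pts (3 * k)" "spread J" "card (side J) = 2 * k - 1"
    and k: "j + m + 2 = k"
  shows "(3 * j + 2, 0, 3 * m + 4) \<in> J \<or> (3 * j + 1, 1, 3 * m + 4) \<in> J \<or>
    (3 * j + 2, 1, 3 * m + 3) \<in> J"
proof -
  obtain x y z where p: "(x, y, z) \<in> J" "x + y + z = 3 * k" "y \<le> 1" "(2 * x + y) div 3 = 2 * j + 1"
    using side_tile_hit [OF J, of "2 * j + 1"] k by auto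
  have "6 * j + 3 \<le> 2 * x + y" "2 * x + y \<le> 6 * j + 5"
    using p(4) div_mult_mod_eq [of "2 * x + y" 3] mod_less_divisor [of 3 "2 * x + y"] by linarith+
  with p(3) have "(y = 0 \<and> (x = 3 * j + 2)) \<or> (y = 1 \<and> (x = 3 * j + 1 \<or> x = 3 * j + 2))"
    by (cases y) auto
  with p(2) k have "(x = 3 * j + 2 \<and> y = 0 \<and> z = 3 * m + 4) \<or> (x = 3 * j + 1 \<and> y = 1 \<and> z = 3 * m + 4) \<or>
    (x = 3 * j + 2 \<and> y = 1 \<and> z = 3 * m + 3)"
    by auto
  with p(1) show ?thesis by blast
qed

text \<open>Every tile contains a point of the class: \<open>(3 * j, 0, 3 * m + 3)\<close> for even
  index, \<open>(3 * j + 1, 1, 3 * m + 4)\<close> for odd index. The bound for one strip is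
  therefore attained.\<close>

lemma card_side_diag_class: "card (side (diag_class k)) = 2 * k - 1"
proof -
  let ?f = "\<lambda>(x, y, z). (2 * x + y) div 3 :: nat"
  have "n \<in> ?f ` side (diag_class k)" if n_less: "n < 2 * k - 1" for n
  proof -
    obtain j where "n = 2 * j \<or> n = 2 * j + 1" by (meson oddE evenE)
    then show ?thesis
    proof
      assume n: "n = 2 * j"
      then have "k = j + (k - j - 1) + 1" using n_less by simp
      then obtain m where "k = j + m + 1" by blast
      then have "(3 * j, 0, 3 * m + 3) \<in> side (diag_class k)"
        by (simp add: mem_diag_class)
      then show ?thesis by (rule rev_image_eqI) (simp add: n)
    next
      assume n: "n = 2 * j + 1"
      then have "k = j + (k - j - 2) + 2" using n_less by simp
      then obtain m where "k = j + m + 2" by blast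
      then have "(3 * j + 1, 1, 3 * m + 4) \<in> side (diag_class k)"
        by (simp add: mem_diag_class)
      then show ?thesis by (rule rev_image_eqI) (simp add: n)
    qed
  qed
  then have "{..<2 * k - 1} \<subseteq> ?f ` side (diag_class k)" by blast
  from surj_card_le [OF finite_side [OF diag_class_subset] this]
  show ?thesis
    using card_side_le [OF diag_class_subset spread_diag_class, of k] by simp
qed

text \<open>The points of the boundary annulus \<open>min x (min y z) \<le> 1\<close> split into three rotated copies of
  the strip; for \<open>k = 1\<close> the centre \<open>(1, 1, 1)\<close> belongs to none of them.\<close>

lemma card_split:
  assumes J: "J \<subseteq> simplex_pts (3 * k)" and k: "1 \<le> k"
  shows "card J = card (inner J) + card (J \<inter> {(1, 1, 1)}) +
    card (side J) + card (side (rot J)) + card (side (rot (rot J)))"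
proof -
  let ?sh = "\<lambda>(x, y, z). (x + 2, y + 2, z + 2) :: nat \<times> nat \<times> nat"
  \<comment> \<open>The other two strips are rotated back to the coordinates of \<open>J\<close>,
    and the inner part is shifted back by 2.\<close>
  define A where "A = rot (rot (side (rot J)))"
  define B where "B = rot (side (rot (rot J)))"
  define D where "D = ?sh ` inner J"
  define E where "E = J \<inter> {(1, 1, 1)}"
  have mem: "(x, y, z) \<in> A \<longleftrightarrow> (x, y, z) \<in> J \<and> x \<le> 1 \<and> 2 \<le> y"
    "(x, y, z) \<in> B \<longleftrightarrow> (x, y, z) \<in> J \<and> z \<le> 1 \<and> 2 \<le> x"
    "(x, y, z) \<in> D \<longleftrightarrow> (x, y, z) \<in> J \<and> 2 \<le> x \<and> 2 \<le> y \<and> 2 \<le> z"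
    "(x, y, z) \<in> E \<longleftrightarrow> (x, y, z) \<in> J \<and> x = 1 \<and> y = 1 \<and> z = 1" for x y z
  proof -
    show "(x, y, z) \<in> A \<longleftrightarrow> (x, y, z) \<in> J \<and> x \<le> 1 \<and> 2 \<le> y"
      "(x, y, z) \<in> B \<longleftrightarrow> (x, y, z) \<in> J \<and> z \<le> 1 \<and> 2 \<le> x"
      "(x, y, z) \<in> E \<longleftrightarrow> (x, y, z) \<in> J \<and> x = 1 \<and> y = 1 \<and> z = 1"
      by (auto simp: A_def B_def E_def)
    show "(x, y, z) \<in> D \<longleftrightarrow> (x, y, z) \<in> J \<and> 2 \<le> x \<and> 2 \<le> y \<and> 2 \<le> z"
    proof
      assume "(x, y, z) \<in> J \<and> 2 \<le> x \<and> 2 \<le> y \<and> 2 \<le> z"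
      then show "(x, y, z) \<in> D"
        unfolding D_def by (intro rev_image_eqI [of "(x - 2, y - 2, z - 2)"]) auto
    qed (auto simp: D_def)
  qed
  have fin: "finite J" using J finite_simplex_pts finite_subset by blast
  have sub: "A \<subseteq> J" "B \<subseteq> J" "D \<subseteq> J" "E \<subseteq> J" "side J \<subseteq> J" using mem by auto
  have cover: "(x, y, z) \<in> D \<union> E \<union> side J \<union> A \<union> B" if p: "(x, y, z) \<in> J" for x y z
  proof -
    \<comment> \<open>If some entries are at most 1 and others are larger, then in cyclic order a
      small one is followed by a large one. If all are at most 1, the positive multiple
      \<open>3 * k\<close> forces \<open>(1, 1, 1)\<close>.\<close>
    have "x + y + z = 3 * k" using J p by auto
    with k p show ?thesis by (simp add: mem) arith
  qed
  have "J \<subseteq> D \<union> E \<union> side J \<union> A \<union> B"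
    using cover by (metis prod_cases3 subsetI)
  then have "J = D \<union> E \<union> side J \<union> A \<union> B"
    using sub by blast
  moreover have "card (D \<union> E \<union> side J \<union> A \<union> B) =
    card D + card E + card (side J) + card A + card B"
    using sub fin by (subst card_Un_disjoint; auto simp: mem finite_subset)+
  moreover have "card D = card (inner J)"
    unfolding D_def by (rule card_image) (auto simp: inj_on_def)
  ultimately show ?thesis by (simp add: A_def B_def E_def)
qed

section \<open>The largest size of a spread set\<close>

lemma simplex_pts_0: "simplex_pts 0 = {(0, 0, 0)}"
  by (auto simp: simplex_pts_def)

lemma diag_class_0: "diag_class 0 = {(0, 0, 0)}"
  by (auto simp: diag_class_def)

lemma inner_eq_empty:
  assumes "J \<subseteq> simplex_pts d" "d < 6"
  shows "inner J = {}"
  using assms by force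

lemma centre_eq_empty:
  assumes "J \<subseteq> simplex_pts (3 * k)" "k \<noteq> 1"
  shows "J \<inter> {(1, 1, 1)} = {}"
  using assms by force

lemma card_diag_class:
  "card (diag_class 1) = 4" "card (diag_class (k + 2)) = card (diag_class k) + 3 * (2 * k + 3)"
proof -
  have "diag_class 1 \<inter> {(1, 1, 1)} = {(1, 1, 1)}" by (auto simp: mem_diag_class)
  then show "card (diag_class 1) = 4"
    using card_split [OF diag_class_subset, of 1] card_side_diag_class [of 1]
      inner_eq_empty [OF diag_class_subset, of 1] by simp
  show "card (diag_class (k + 2)) = card (diag_class k) + 3 * (2 * k + 3)"
    using card_split [OF diag_class_subset, of "k + 2"] card_side_diag_class [of "k + 2"]
      inner_diag_class [of k] centre_eq_empty [OF diag_class_subset, of "k + 2"]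
    by simp
qed

text \<open>Removing the annulus lowers \<open>k\<close> by 2. Each strip contributes at most as
  much as the strip of the class, and the inner part is bounded by induction; the centre counts only
  for \<open>k = 1\<close>.\<close>

lemma card_le_diag_class:
  assumes "J \<subseteq> simplex_pts (3 * k)" "spread J"
  shows "card J \<le> card (diag_class k)"
  using assms
proof (induction k arbitrary: J rule: less_induct)
  case (less k)
  note sides = card_sides_le [OF less.prems]
  consider "k = 0" | "k = 1" | l where "k = l + 2"
    by (metis One_nat_def add_2_eq_Suc' not0_implies_Suc)
  then show ?case
  proof cases
    case 1
    then show ?thesis using less.prems(1) by (auto simp: simplex_pts_0 diag_class_0 subset_singleton_iff)
  next
    case 2
    have "card (J \<inter> {(1, 1, 1)}) \<le> 1" using card_mono [of "{(1, 1, 1)}" "J \<inter> {(1, 1, 1)}"] by simp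
    then show ?thesis
      using 2 card_split [OF less.prems(1)] sides inner_eq_empty [OF less.prems(1)] card_diag_class(1)
      by simp
  next
    case 3
    have "card (inner J) \<le> card (diag_class l)"
      using 3 less.prems by (intro less.IH) (auto intro!: inner_subset simp: algebra_simps)
    then show ?thesis
      using 3 card_split [OF less.prems(1)] sides centre_eq_empty [OF less.prems(1)]
        card_diag_class(2) [of l]
      by simp
  qed
qed

section \<open>Maximum independent sets\<close>

text \<open>By \<open>card_le_diag_class\<close> the prescribed size is the largest possible
  one.\<close>

definition optimal :: "nat \<Rightarrow> (nat \<times> nat \<times> nat) set \<Rightarrow> bool" where
  "optimal k J \<longleftrightarrow> J \<subseteq> simplex_pts (3 * k) \<and> spread J \<and> card J = card (diag_class k)"

lemma optimal_rot [simp]: "optimal k J \<Longrightarrow> optimal k (rot J)"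
  and optimal_mir [simp]: "optimal k J \<Longrightarrow> optimal k (mir J)"
  by (simp_all add: optimal_def)

lemma optimal_eqI:
  assumes "optimal k J" "diag_class k \<subseteq> J"
  shows "J = diag_class k"
proof -
  have "finite J" using assms(1) finite_simplex_pts finite_subset unfolding optimal_def by blast
  then show ?thesis using assms card_subset_eq unfolding optimal_def by metis
qed

text \<open>The summands in \<open>card_split\<close> are bounded separately and their total attains
  the sum of the bounds, so each of them attains its own.\<close>

lemma optimal_inner:
  assumes "optimal (k + 2) J"
  shows "optimal k (inner J)" "card (side J) = 2 * (k + 2) - 1"
proof -
  have J: "J \<subseteq> simplex_pts (3 * (k + 2))" "spread J" "card J = card (diag_class (k + 2))"
    using assms unfolding optimal_def by auto
  have sub: "inner J \<subseteq> simplex_pts (3 * k)"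
    using J(1) by (intro inner_subset) (simp add: algebra_simps)
  have "card (inner J) \<le> card (diag_class k)"
    using J(2) sub by (simp add: card_le_diag_class)
  with card_sides_le [OF J(1,2)] have "card (inner J) = card (diag_class k) \<and> card (side J) = 2 * (k + 2) - 1"
    using card_split [OF J(1)] centre_eq_empty [OF J(1)] J(3) card_diag_class(2) [of k] by simp
  then show "optimal k (inner J)" "card (side J) = 2 * (k + 2) - 1"
    using sub J(2) by (auto simp: optimal_def)
qed

text \<open>Without the centre only the three strips remain, with at most one point each, while the
  class has four points.\<close>

lemma optimal_1:
  assumes "optimal 1 J"
  shows "(1, 1, 1) \<in> J"
proof (rule ccontr)
  assume "(1, 1, 1) \<notin> J"
  have J: "J \<subseteq> simplex_pts (3 * 1)" "spread J" "card J = 4"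
    using assms card_diag_class(1) unfolding optimal_def by auto
  show False
    using card_sides_le [OF J(1,2)] card_split [OF J(1)] inner_eq_empty [OF J(1)] J(3) \<open>(1, 1, 1) \<notin> J\<close> by simp
qed

lemma optimal_0_eq: "optimal 0 J \<Longrightarrow> J = diag_class 0"
  by (auto simp: optimal_def simplex_pts_0 diag_class_0 subset_singleton_iff)

text \<open>The disjuncts move one unit between two coordinates in the six possible ways. Stated by
  equations, adjacency of concrete triples becomes plain arithmetic.\<close>

lemma spread_adjacent:
  assumes "spread J" "(x, y, z) \<in> J"
    and "x' = x + 1 \<and> y = y' + 1 \<and> z = z' \<or> x = x' + 1 \<and> y' = y + 1 \<and> z = z' \<or>
      x' = x + 1 \<and> y = y' \<and> z = z' + 1 \<or> x = x' + 1 \<and> y = y' \<and> z' = z + 1 \<or>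
      x = x' \<and> y' = y + 1 \<and> z = z' + 1 \<or> x = x' \<and> y = y' + 1 \<and> z' = z + 1"
  shows "(x', y', z') \<notin> J"
  using assms(2,3) spreadD [OF assms(1)] by auto

text \<open>The centre excludes its six neighbours, so only the three corners can accompany
  it.\<close>

lemma optimal_1_eq:
  assumes "optimal 1 J"
  shows "J = diag_class 1"
proof -
  have J: "J \<subseteq> simplex_pts 3" "spread J" "card J = card (diag_class 1)"
    using assms unfolding optimal_def by auto
  note nb = spread_adjacent [OF J(2) optimal_1 [OF assms]]
  have "(x, y, z) \<in> diag_class 1" if p: "(x, y, z) \<in> J" for x y z
  proof -
    have "x + y + z = 3" using J(1) p by auto
    moreover have "\<not> (x = 2 \<and> y = 1)" "\<not> (x = 2 \<and> z = 1)" "\<not> (y = 2 \<and> x = 1)"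
      "\<not> (y = 2 \<and> z = 1)" "\<not> (z = 2 \<and> x = 1)" "\<not> (z = 2 \<and> y = 1)"
      using \<open>x + y + z = 3\<close> nb [of x y z] p by auto
    ultimately have "x = 3 \<and> y = 0 \<and> z = 0 \<or> x = 0 \<and> y = 3 \<and> z = 0 \<or>
      x = 0 \<and> y = 0 \<and> z = 3 \<or> x = 1 \<and> y = 1 \<and> z = 1"
      by presburger
    then show ?thesis by (auto simp: mem_diag_class)
  qed
  then have "J \<subseteq> diag_class 1" by auto
  moreover have "finite (diag_class 1)"
    by (rule finite_subset [OF diag_class_subset finite_simplex_pts])
  ultimately show ?thesis using J(3) by (simp add: card_subset_eq)
qed

lemma optimal_card_side:
  assumes "optimal k J" "2 \<le> k"
  shows "card (side J) = 2 * k - 1"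
  using optimal_inner(2) [of "k - 2" J] assms by simp

lemma optimal_up_hit:
  assumes "optimal k J" "2 \<le> k" "j + m + 1 = k"
  shows "(3 * j, 0, 3 * m + 3) \<in> J \<or> (3 * j + 1, 0, 3 * m + 2) \<in> J \<or> (3 * j, 1, 3 * m + 2) \<in> J"
  using side_up_hit [OF _ _ optimal_card_side [OF assms(1,2)] assms(3)] assms(1)
  by (simp add: optimal_def)

lemma optimal_down_hit:
  assumes "optimal k J" "j + m + 2 = k"
  shows "(3 * j + 2, 0, 3 * m + 4) \<in> J \<or> (3 * j + 1, 1, 3 * m + 4) \<in> J \<or>
    (3 * j + 2, 1, 3 * m + 3) \<in> J"
  using side_down_hit [OF _ _ optimal_card_side [OF assms(1)] assms(2)] assms
  by (simp add: optimal_def)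

section \<open>From the inner part to the whole set\<close>

lemma rot_rot_rot [simp]: "rot (rot (rot J)) = J"
  by (auto simp: rot_def)

lemma inner_rot: "inner (rot J) = rot (inner J)"
  and inner_mir: "inner (mir J) = mir (inner J)"
  by (auto simp: rot_def mir_def inner_def)

text \<open>Since the class is invariant under rotation, its other two strips can be tested as the
  same strip against rotations of \<open>J\<close>.\<close>

lemma diag_class_subsetI:
  assumes "2 \<le> k" "inner J = diag_class (k - 2)"
    and "side (diag_class k) \<subseteq> J" "side (diag_class k) \<subseteq> rot J" "side (diag_class k) \<subseteq> rot (rot J)"
  shows "diag_class k \<subseteq> J"
proof -
  have "(x, y, z) \<in> J" if p: "(x, y, z) \<in> diag_class k" for x y z
  proof -
    have "x + y + z = 3 * k" using p by (simp add: mem_diag_class)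
    \<comment> \<open>The sum is at least 6, so not all entries are at most 1.\<close>
    with assms(1) consider "2 \<le> x" "2 \<le> y" "2 \<le> z" | "y \<le> 1" "2 \<le> z" | "x \<le> 1" "2 \<le> y"
      | "z \<le> 1" "2 \<le> x" by linarith
    then show ?thesis
    proof cases
      case 1
      then obtain a b c where abc: "x = a + 2" "y = b + 2" "z = c + 2"
        by (metis le_iff_add add.commute)
      have "k = k - 2 + 2" using assms(1) by simp
      then have "(a, b, c) \<in> inner (diag_class (k - 2 + 2))"
        using p abc by simp
      then have "(a, b, c) \<in> inner J" by (simp only: inner_diag_class assms(2))
      then show ?thesis using abc by simp
    next
      case 2
      then show ?thesis using p assms(3) by auto
    next
      case 3
      then have "(z, x, y) \<in> side (diag_class k)" using p by (auto simp: mem_diag_class)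
      then have "(z, x, y) \<in> rot J" using assms(4) by blast
      then show ?thesis by simp
    next
      case 4
      then have "(y, z, x) \<in> side (diag_class k)" using p by (auto simp: mem_diag_class)
      then have "(y, z, x) \<in> rot (rot J)" using assms(5) by blast
      then show ?thesis by simp
    qed
  qed
  then show ?thesis by auto
qed

lemma side_diag_class_cases:
  assumes "(x, y, z) \<in> side (diag_class k)"
  obtains j m where "j + m + 1 = k" "x = 3 * j" "y = 0" "z = 3 * m + 3"
    | j m where "j + m + 2 = k" "x = 3 * j + 1" "y = 1" "z = 3 * m + 4"
proof -
  have p: "x + y + z = 3 * k" "x mod 3 = y mod 3" "y \<le> 1" "2 \<le> z"
    using assms by (auto simp: mem_diag_class)
  define j where "j = x div 3"
  have "y = 0 \<and> x = 3 * j \<or> y = 1 \<and> x = 3 * j + 1"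
    using p(2,3) div_mult_mod_eq [of x 3] unfolding j_def by (cases y) auto
  then show thesis
  proof
    assume "y = 0 \<and> x = 3 * j"
    then show thesis using p(1,4) by (intro that(1) [of j "k - j - 1"]) auto
  next
    assume "y = 1 \<and> x = 3 * j + 1"
    then show thesis using p(1,4) by (intro that(2) [of j "k - j - 2"]) auto
  qed
qed

text \<open>The inner class fills the row \<open>y = 2\<close> with points at step 3, which block
  points of the row \<open>y = 1\<close>. With parameter at least 3 there are two consecutive such
  points, and the tiles between them are forced.\<close>

lemma optimal_boundary:
  assumes J: "optimal (n + 3) J" and inn: "inner J = diag_class (n + 1)"
  shows "j + m = n \<Longrightarrow> (3 * j + 4, 1, 3 * m + 4) \<in> J"
    "j + m = n \<Longrightarrow> (3 * j + 3, 0, 3 * m + 6) \<in> J"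
    "(1, 1, 3 * n + 7) \<in> J"
proof -
  have sp: "spread J" using J by (simp add: optimal_def)
  note adj = spread_adjacent [OF sp]
  have E: "(3 * j + 2, 2, 3 * m + 2) \<in> J" if "j + m = n + 1" for j m
  proof -
    have "(3 * j, 0, 3 * m) \<in> inner J" unfolding inn using that by (simp add: mem_diag_class)
    then show ?thesis by simp
  qed
  have S: "(3 * j + 4, 1, 3 * m + 4) \<in> J" if jm: "j + m = n" for j m
  proof -
    \<comment> \<open>This tile and the mirrored one below share
      \<open>(3 * j + 4, 1, 3 * m + 4)\<close>. The row \<open>y = 2\<close> excludes one further
      point of each, and the two points left over, both with \<open>y = 0\<close>, are adjacent and
      cannot both be chosen.\<close>
    have "(3 * j + 5, 0, 3 * m + 4) \<in> J \<or> (3 * j + 4, 1, 3 * m + 4) \<in> J \<or>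
      (3 * j + 5, 1, 3 * m + 3) \<in> J"
      using optimal_down_hit [OF J, of "j + 1" m] jm by (simp add: algebra_simps)
    moreover have "(3 * j + 4, 0, 3 * m + 5) \<in> J \<or> (3 * j + 4, 1, 3 * m + 4) \<in> J \<or>
      (3 * j + 3, 1, 3 * m + 5) \<in> J"
      using optimal_down_hit [OF optimal_mir [OF J], of "m + 1" j] jm by (simp add: algebra_simps)
    moreover have "(3 * j + 5, 1, 3 * m + 3) \<notin> J"
      by (rule adj [OF E [of "j + 1" m]]) (use jm in simp_all)
    moreover have "(3 * j + 3, 1, 3 * m + 5) \<notin> J"
      by (rule adj [OF E [of j "m + 1"]]) (use jm in simp_all)
    moreover have "(3 * j + 5, 0, 3 * m + 4) \<notin> J" if "(3 * j + 4, 0, 3 * m + 5) \<in> J"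
      using that by (rule adj) simp
    ultimately show ?thesis by blast
  qed
  have P: "(3 * j + 3, 0, 3 * m + 6) \<in> J" if jm: "j + m = n" for j m
  proof -
    have "(3 * j + 3, 0, 3 * m + 6) \<in> J \<or> (3 * j + 4, 0, 3 * m + 5) \<in> J \<or>
      (3 * j + 3, 1, 3 * m + 5) \<in> J"
      using optimal_up_hit [OF J, of "j + 1" "m + 1"] jm by (simp add: algebra_simps)
    moreover have "(3 * j + 4, 0, 3 * m + 5) \<notin> J"
      using S [OF jm] by (rule adj) simp
    moreover have "(3 * j + 3, 1, 3 * m + 5) \<notin> J"
      by (rule adj [OF E [of j "m + 1"]]) (use jm in simp_all)
    ultimately show ?thesis by blast
  qed
  show "j + m = n \<Longrightarrow> (3 * j + 4, 1, 3 * m + 4) \<in> J"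
    "j + m = n \<Longrightarrow> (3 * j + 3, 0, 3 * m + 6) \<in> J"
    by (fact S P)+
  \<comment> \<open>The first inverted tile lacks a left neighbour in the row \<open>y = 2\<close>;
    the boundary point \<open>(3, 0, 3 * n + 6)\<close> just found excludes the remaining
    competitor.\<close>
  have "(2, 0, 3 * n + 7) \<in> J \<or> (1, 1, 3 * n + 7) \<in> J \<or> (2, 1, 3 * n + 6) \<in> J"
    using optimal_down_hit [OF J, of 0 "n + 1"] by (simp add: algebra_simps)
  moreover have "(2, 0, 3 * n + 7) \<notin> J"
    by (rule adj [OF P [of 0 n]]) simp_all
  moreover have "(2, 1, 3 * n + 6) \<notin> J"
    by (rule adj [OF E [of 0 "n + 1"]]) simp_all
  ultimately show "(1, 1, 3 * n + 7) \<in> J" by blast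
qed

text \<open>Away from the ends of the strip the points come from \<open>optimal_boundary\<close>.
  Near each end, a point with two entries 1 blocks two vertices of the last upright tile and leaves
  the required one.\<close>

lemma side_diag_class_subset:
  assumes J: "optimal (n + 3) J" and inn: "inner J = diag_class (n + 1)"
  shows "side (diag_class (n + 3)) \<subseteq> J"
proof -
  have sp: "spread J" using J by (simp add: optimal_def)
  note adj = spread_adjacent [OF sp]
  note bd = optimal_boundary [OF J inn]
  have c: "(1, 1, 3 * n + 7) \<in> J" by (rule bd(3))
  \<comment> \<open>This point has \<open>z = 1\<close> and lies outside the strip of
    \<open>J\<close>, but it is accessible through the mirror image.\<close>
  have c': "(3 * n + 7, 1, 1) \<in> J"
    using optimal_boundary(3) [OF optimal_mir [OF J]] inn by (simp add: inner_mir)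
  have "(0, 0, 3 * n + 9) \<in> J \<or> (1, 0, 3 * n + 8) \<in> J \<or> (0, 1, 3 * n + 8) \<in> J"
    using optimal_up_hit [OF J, of 0 "n + 2"] by (simp add: algebra_simps)
  moreover have "(1, 0, 3 * n + 8) \<notin> J" "(0, 1, 3 * n + 8) \<notin> J"
    by (rule adj [OF c]; simp)+
  ultimately have left: "(0, 0, 3 * n + 9) \<in> J" by blast
  have "(3 * n + 6, 0, 3) \<in> J \<or> (3 * n + 7, 0, 2) \<in> J \<or> (3 * n + 6, 1, 2) \<in> J"
    using optimal_up_hit [OF J, of "n + 2" 0] by (simp add: algebra_simps)
  moreover have "(3 * n + 7, 0, 2) \<notin> J"
    using c' by (rule adj) simp
  moreover have "(3 * n + 6, 1, 2) \<notin> J"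
    using c' by (rule adj) simp
  ultimately have right: "(3 * n + 6, 0, 3) \<in> J" by blast
  have "(x, y, z) \<in> J" if p: "(x, y, z) \<in> side (diag_class (n + 3))" for x y z
    using p
  proof (cases rule: side_diag_class_cases)
    case (1 j m)
    consider "j = 0" | "m = 0" | a b where "j = a + 1" "m = b + 1" by (metis Suc_eq_plus1 nat.exhaust)
    then show ?thesis
    proof cases
      case 1
      then show ?thesis using \<open>j + m + 1 = n + 3\<close> left \<open>x = _\<close> \<open>y = _\<close> \<open>z = _\<close> by (simp add: algebra_simps)
    next
      case 2
      then show ?thesis using \<open>j + m + 1 = n + 3\<close> right \<open>x = _\<close> \<open>y = _\<close> \<open>z = _\<close> by (simp add: algebra_simps)
    next
      case 3
      then show ?thesis using 1 bd(2) [of a b] by (simp add: algebra_simps)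
    qed
  next
    case (2 j m)
    show ?thesis
    proof (cases j)
      case 0
      then show ?thesis using 2 c by (auto simp: algebra_simps)
    next
      case (Suc a)
      then show ?thesis using 2 bd(1) [of a m] by (simp add: algebra_simps)
    qed
  qed
  then show ?thesis by auto
qed

lemma optimal_eq_if_inner:
  assumes J: "optimal (n + 3) J" and inn: "inner J = diag_class (n + 1)"
  shows "J = diag_class (n + 3)"
proof (rule optimal_eqI [OF J])
  show "diag_class (n + 3) \<subseteq> J"
  proof (rule diag_class_subsetI)
    show "side (diag_class (n + 3)) \<subseteq> J"
      by (rule side_diag_class_subset [OF J inn])
    show "side (diag_class (n + 3)) \<subseteq> rot J"
      using J inn by (intro side_diag_class_subset) (simp_all add: inner_rot)
    show "side (diag_class (n + 3)) \<subseteq> rot (rot J)"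
      using J inn by (intro side_diag_class_subset) (simp_all add: inner_rot)
  qed (simp_all add: inn)
qed

section \<open>The exceptional parameters 2 and 4\<close>

lemma optimal_2_centre:
  assumes "optimal 2 J"
  shows "(2, 2, 2) \<in> J"
proof -
  have "inner J = {(0, 0, 0)}"
    using optimal_inner(1) [of 0 J] assms optimal_0_eq diag_class_0 by simp
  then have "(0, 0, 0) \<in> inner J" by simp
  then show ?thesis by simp
qed

text \<open>The centre \<open>(2, 2, 2)\<close> and the absence of \<open>(2, 0, 4)\<close> force
  one point after another along the side. The last one, \<open>(4, 1, 1)\<close>, excludes
  \<open>(4, 2, 0)\<close>, which is the same hypothesis for \<open>rot (rot J)\<close>.\<close>

lemma optimal_2_side:
  assumes J: "optimal 2 J" and n: "(2, 0, 4) \<notin> J"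
  shows "side (diag_class 2) \<subseteq> J" "(2, 0, 4) \<notin> rot (rot J)"
proof -
  have sp: "spread J" using J by (simp add: optimal_def)
  note adj = spread_adjacent [OF sp]
  note c = optimal_2_centre [OF J]
  have "(2, 1, 3) \<notin> J" "(3, 1, 2) \<notin> J"
    by (rule adj [OF c]; simp)+
  then have a: "(1, 1, 4) \<in> J" and b: "(3, 0, 3) \<in> J"
    using optimal_down_hit [OF J, of 0 0] optimal_up_hit [OF optimal_mir [OF J], of 1 0] n by auto
  have "(4, 0, 2) \<notin> J" using b by (rule adj) simp
  then have d: "(4, 1, 1) \<in> J"
    using optimal_down_hit [OF optimal_mir [OF J], of 0 0] \<open>(3, 1, 2) \<notin> J\<close> by auto
  have "(4, 2, 0) \<notin> J" using d by (rule adj) simp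
  then show "(2, 0, 4) \<notin> rot (rot J)" by simp
  have "(1, 0, 5) \<notin> J" "(0, 1, 5) \<notin> J"
    by (rule adj [OF a]; simp)+
  then have e: "(0, 0, 6) \<in> J"
    using optimal_up_hit [OF J, of 0 1] by auto
  have "(x, y, z) \<in> J" if p: "(x, y, z) \<in> side (diag_class 2)" for x y z
    using p
  proof (cases rule: side_diag_class_cases)
    case (1 j m)
    then have "j = 0 \<and> m = 1 \<or> j = 1 \<and> m = 0" by linarith
    then show ?thesis using 1 e b by auto
  next
    case (2 j m)
    then show ?thesis using a by auto
  qed
  then show "side (diag_class 2) \<subseteq> J" by auto
qed

lemma optimal_2_eq:
  assumes J: "optimal 2 J" and n: "(2, 0, 4) \<notin> J"
  shows "J = diag_class 2"
proof (rule optimal_eqI [OF J])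
  note 1 = optimal_2_side [OF J n]
  \<comment> \<open>The absent point propagates around the triangle, so all three sides are
    covered.\<close>
  note 2 = optimal_2_side [OF optimal_rot [OF optimal_rot [OF J]] 1(2)]
  have "(2, 0, 4) \<notin> rot J" using 2(2) by simp
  note 3 = optimal_2_side [OF optimal_rot [OF J] this]
  have "inner J = diag_class (2 - 2)"
    using optimal_inner(1) [of 0 J] J optimal_0_eq by simp
  with 1(1) 2(1) 3(1) show "diag_class 2 \<subseteq> J"
    by (intro diag_class_subsetI) auto
qed

text \<open>For \<open>k = 2\<close> the triples of even numbers form a second optimal set.\<close>

lemma optimal_2_cases:
  assumes J: "optimal 2 J"
  shows "J = diag_class 2 \<or> (0, 0, 6) \<in> J \<and> (2, 0, 4) \<in> J"
proof (cases "(2, 0, 4) \<in> J")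
  case True
  have sp: "spread J" using J by (simp add: optimal_def)
  note adj = spread_adjacent [OF sp]
  have "(0, 2, 4) \<in> J"
  proof (rule ccontr)
    assume "(0, 2, 4) \<notin> J"
    \<comment> \<open>\<open>mir (rot J)\<close> exchanges the first two coordinates, so the absence
      of \<open>(0, 2, 4)\<close> from \<open>J\<close> is the hypothesis of
      \<open>optimal_2_eq\<close> for it.\<close>
    then have "mir (rot J) = diag_class 2"
      using J by (intro optimal_2_eq) simp_all
    moreover have "(0, 2, 4) \<in> mir (rot J)" using True by simp
    ultimately show False by (simp add: mem_diag_class)
  qed
  then have "(0, 1, 5) \<notin> J" by (rule adj) simp
  moreover have "(1, 0, 5) \<notin> J" using True by (rule adj) simp
  ultimately have "(0, 0, 6) \<in> J"
    using optimal_up_hit [OF J, of 0 1] by auto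
  then show ?thesis using True by simp
qed (use optimal_2_eq [OF J] in simp)

text \<open>Any other inner part gives the points \<open>(2, 2, 8)\<close> and
  \<open>(4, 2, 6)\<close>. They leave one choice in an inverted tile and one in a mirrored tile,
  and these two choices are adjacent.\<close>

lemma optimal_4_inner:
  assumes J: "optimal 4 J"
  shows "inner J = diag_class 2"
proof (rule ccontr)
  assume "inner J \<noteq> diag_class 2"
  moreover have "optimal 2 (inner J)"
    using optimal_inner(1) [of 2 J] J by simp
  ultimately have "(0, 0, 6) \<in> inner J" "(2, 0, 4) \<in> inner J"
    using optimal_2_cases by blast+
  then have i: "(2, 2, 8) \<in> J" "(4, 2, 6) \<in> J" by simp_all
  have sp: "spread J" using J by (simp add: optimal_def)
  note adj = spread_adjacent [OF sp]
  have "(4, 1, 7) \<notin> J" "(5, 1, 6) \<notin> J"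
    by (rule adj [OF i(2)]; simp)+
  moreover have "(3, 1, 8) \<notin> J"
    by (rule adj [OF i(1)]) simp
  ultimately have a: "(5, 0, 7) \<in> J" and b: "(4, 0, 8) \<in> J"
    using optimal_down_hit [OF J, of 1 1] optimal_down_hit [OF optimal_mir [OF J], of 2 0] by auto
  have "(4, 0, 8) \<notin> J" using a by (rule adj) simp
  with b show False by blast
qed

lemma optimal_unique:
  assumes "optimal k J" "k \<noteq> 2"
  shows "J = diag_class k"
  using assms
proof (induction k arbitrary: J rule: less_induct)
  case (less k)
  \<comment> \<open>For \<open>k \<ge> 3\<close> the inner part has parameter \<open>k - 2\<close>,
    which is the excluded value 2 exactly when \<open>k = 4\<close>.\<close>
  have "k = 0 \<or> k = 1 \<or> k = 4 \<or> k = k - 3 + 3 \<and> k - 3 + 1 \<noteq> 2"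
    using less.prems(2) by auto
  then consider "k = 0" | "k = 1" | "k = 4" | n where "k = n + 3" "n + 1 \<noteq> 2"
    by blast
  then show ?case
  proof cases
    case 1
    then show ?thesis using less.prems(1) optimal_0_eq by simp
  next
    case 2
    then show ?thesis using less.prems(1) optimal_1_eq by simp
  next
    case 3
    then show ?thesis
      using optimal_eq_if_inner [of 1 J] optimal_4_inner less.prems(1) by (simp add: eval_nat_numeral)
  next
    case 4
    have "optimal (n + 1) (inner J)"
      using optimal_inner(1) [of "n + 1" J] less.prems(1) 4(1) by (simp add: algebra_simps)
    then have "inner J = diag_class (n + 1)"
      using 4 less.IH [of "n + 1"] by simp
    then show ?thesis using optimal_eq_if_inner [of n J] less.prems(1) 4(1) by simp
  qed
qed

section \<open>Monomials as triples\<close>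

definition exponents :: "monomial \<Rightarrow> nat \<times> nat \<times> nat" where
  "exponents f = (Poly_Mapping.lookup f 1, Poly_Mapping.lookup f 2, Poly_Mapping.lookup f 3)"

lemma mono_degree_3:
  assumes "Poly_Mapping.keys f \<subseteq> {1..3}"
  shows "mono_degree f = Poly_Mapping.lookup f 1 + Poly_Mapping.lookup f 2 + Poly_Mapping.lookup f 3"
proof -
  have "mono_degree f = (\<Sum>i\<in>{1..3}. Poly_Mapping.lookup f i)"
    unfolding mono_degree_def
    by (rule sum.mono_neutral_left [OF _ assms]) (auto simp: in_keys_iff)
  also have "{1..3} = {1, 2, 3 :: nat}" by auto
  finally show ?thesis by simp
qed

lemma exponents_mem:
  assumes "f \<in> monomials 3 d"
  shows "exponents f \<in> simplex_pts d"
  using assms mono_degree_3 [of f] by (simp add: monomials_def exponents_def)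

lemma bij_betw_exponents: "bij_betw exponents (monomials 3 d) (simplex_pts d)"
proof (rule bij_betw_imageI)
  show "inj_on exponents (monomials 3 d)"
  proof (rule inj_onI)
    fix f g assume fg: "f \<in> monomials 3 d" "g \<in> monomials 3 d" "exponents f = exponents g"
    have "Poly_Mapping.lookup f i = Poly_Mapping.lookup g i" for i
    proof (cases "i \<in> {1..3}")
      case True
      then have "i = 1 \<or> i = 2 \<or> i = 3" by auto
      then show ?thesis using fg(3) by (auto simp: exponents_def)
    next
      case False
      then have "i \<notin> Poly_Mapping.keys f" "i \<notin> Poly_Mapping.keys g"
        using fg(1,2) by (auto simp: monomials_def)
      then show ?thesis by (simp add: in_keys_iff)
    qed
    then show "f = g" by (rule poly_mapping_eqI)
  qed
  have "(x, y, z) \<in> exponents ` monomials 3 d" if p: "x + y + z = d" for x y z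
  proof -
    define f :: monomial
      where "f = Poly_Mapping.single 1 x + Poly_Mapping.single 2 y + Poly_Mapping.single 3 z"
    have l: "Poly_Mapping.lookup f i =
      (if i = 1 then x else if i = 2 then y else if i = 3 then z else 0)" for i
      by (simp add: f_def lookup_add lookup_single when_def)
    then have k: "Poly_Mapping.keys f \<subseteq> {1..3}"
      by (auto simp: in_keys_iff split: if_splits)
    have "f \<in> monomials 3 d" using mono_degree_3 [OF k] k p by (simp add: monomials_def l)
    then show ?thesis by (rule rev_image_eqI) (simp add: exponents_def l)
  qed
  then show "exponents ` monomials 3 d = simplex_pts d"
    using exponents_mem by fastforce
qed

lemma mono_degree_lcm:
  assumes "f \<in> monomials 3 d" "g \<in> monomials 3 d"
    and "exponents f = (x, y, z)" "exponents g = (x', y', z')"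
  shows "mono_degree (mono_lcm f g) = max x x' + max y y' + max z z'"
proof -
  have "Poly_Mapping.keys (mono_lcm f g) \<subseteq> {1..3}"
    using assms(1,2) by (auto simp: monomials_def in_keys_iff mono_lcm.rep_eq subset_iff max_def
        split: if_splits)
  from mono_degree_3 [OF this] show ?thesis
    using assms(3,4) by (simp add: mono_lcm.rep_eq exponents_def)
qed

text \<open>For distinct monomials of degree \<open>d\<close>, an lcm of degree \<open>d + 1\<close>
  means that their exponents differ by moving one unit between two variables.\<close>

lemma indep_iff_spread:
  assumes J: "J \<subseteq> monomials 3 d"
  shows "indep J (G_edges 3 d) \<longleftrightarrow> spread (exponents ` J)"
proof
  assume ind: "indep J (G_edges 3 d)"
  have *: False if pq: "(x, y, z) \<in> exponents ` J" "(x', y', z') \<in> exponents ` J"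
    "(x, y, z) \<noteq> (x', y', z')" "max x x' + max y y' + max z z' = x + y + z + 1" for x y z x' y' z'
  proof -
    obtain f g where fg: "f \<in> J" "g \<in> J" "exponents f = (x, y, z)" "exponents g = (x', y', z')"
      using pq(1,2) by force
    then have m: "f \<in> monomials 3 d" "g \<in> monomials 3 d" "f \<noteq> g" using J pq(3) by auto
    then have "x + y + z = d" using exponents_mem [of f d] fg(3) by simp
    then have "{f, g} \<in> G_edges 3 d"
      using mono_degree_lcm [OF m(1,2) fg(3,4)] pq(4) m unfolding G_edges_def by auto
    then show False using ind fg(1,2) m(3) by (auto simp: indep_def)
  qed
  show "spread (exponents ` J)"
    unfolding spread_def by (intro allI conjI notI; elim conjE; drule (1) *) auto
next
  assume sp: "spread (exponents ` J)"
  have "{f, g} \<notin> G_edges 3 d" if fg: "f \<in> J" "g \<in> J" "f \<noteq> g" for f g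
  proof
    assume edge: "{f, g} \<in> G_edges 3 d"
    obtain x y z x' y' z' where e: "exponents f = (x, y, z)" "exponents g = (x', y', z')"
      by (metis prod_cases3)
    have m: "f \<in> monomials 3 d" "g \<in> monomials 3 d" using fg J by auto
    have "max x x' + max y y' + max z z' = d + 1"
      \<comment> \<open>The edge is an unordered pair, so both orders of the lcm are
        supplied.\<close>
      using edge mono_degree_lcm [OF m e] mono_degree_lcm [OF m(2,1) e(2,1)]
      unfolding G_edges_def by (auto simp: doubleton_eq_iff max.commute)
    moreover have s: "x + y + z = d" "x' + y' + z' = d"
      using exponents_mem m e by force+
    \<comment> \<open>The excess of the maxima over \<open>d\<close> is the total increase from the
      first triple to the second. It is 1, and so is the total decrease, as the sums agree.\<close>
    ultimately have "x' = x + 1 \<and> y = y' + 1 \<and> z = z' \<or> x = x' + 1 \<and> y' = y + 1 \<and> z = z' \<or>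
      x' = x + 1 \<and> y = y' \<and> z = z' + 1 \<or> x = x' + 1 \<and> y = y' \<and> z' = z + 1 \<or>
      x = x' \<and> y' = y + 1 \<and> z = z' + 1 \<or> x = x' \<and> y = y' + 1 \<and> z' = z + 1"
      by (cases "x \<le> x'"; cases "y \<le> y'"; cases "z \<le> z'") (auto simp: max_def)
    moreover have "(x, y, z) \<in> exponents ` J" using e(1) fg(1) by force
    ultimately have "(x', y', z') \<notin> exponents ` J"
      using spread_adjacent [OF sp] by blast
    then show False using e(2) fg(2) by force
  qed
  then show "indep J (G_edges 3 d)" by (auto simp: indep_def)
qed

theorem theorem2p1:
  fixes d :: nat
  assumes "d mod 3 = 0" and "d \<noteq> 6"
  shows "num_max_indep 3 d = 1"
proof -
  let ?V = "monomials 3 d" and ?E = "G_edges 3 d"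
  obtain k where d: "d = 3 * k" using assms(1) by auto
  then have k: "k \<noteq> 2" using assms(2) by auto
  have inj: "inj_on exponents ?V" and surj: "exponents ` ?V = simplex_pts (3 * k)"
    using bij_betw_exponents [of d] unfolding bij_betw_def d by auto
  have card: "card (exponents ` J) = card J" if "J \<subseteq> ?V" for J
    by (rule card_image [OF inj_on_subset [OF inj that]])
  have sub: "exponents ` J \<subseteq> simplex_pts (3 * k)" if "J \<subseteq> ?V" for J
    using that surj by blast
  define I where "I = {f \<in> ?V. exponents f \<in> diag_class k}"
  have "exponents ` I = exponents ` ?V \<inter> diag_class k" unfolding I_def by blast
  then have I: "I \<subseteq> ?V" "exponents ` I = diag_class k"
    using surj diag_class_subset [of k] by (auto simp: I_def)
  have indI: "indep I ?E"
    using indep_iff_spread [OF I(1)] I(2) spread_diag_class by simp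
  have le: "card J \<le> card I" if "J \<subseteq> ?V" "indep J ?E" for J
    using card_le_diag_class [OF sub [OF that(1)]] indep_iff_spread that card [OF that(1)]
      card [OF I(1)] I(2) by simp
  \<comment> \<open>Equal images suffice here, as \<open>exponents\<close> is injective on the
    vertices.\<close>
  have "J = I" if J: "J \<subseteq> ?V" "indep J ?E" "card I \<le> card J" for J
  proof -
    have "optimal k (exponents ` J)"
      using sub J indep_iff_spread le [OF J(1,2)] card [OF J(1)] card [OF I(1)] I(2)
      unfolding optimal_def by simp
    then have "exponents ` J = exponents ` I" using optimal_unique k I(2) by simp
    then show ?thesis using inj_on_image_eq_iff [OF inj J(1) I(1)] by simp
  qed
  then have "max_indep_sets ?V ?E = {I}"
    using I(1) indI le unfolding max_indep_sets_def by blast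
  then show ?thesis by (simp add: num_max_indep_def)
qed

end
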